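(* Let $U\subset\mathbb{R}^2$ be an open connected set, let $f=(f_1,f_2):U\to\mathbb{R}^2$ be a $C^2$ map such that $\det Df(z)\neq 0$ for every $z\in U$, and let $z_0\in U$ be such that $f(z_0)=(0,0)$. Let $H_f=\frac{f_1^2+f_2^2}{2}:U\to\mathbb{R}$, let $\nabla H_f^{\perp}=(-(H_f)_y,(H_f)_x)$ be the associated Hamiltonian vector field on $U$ (for which $z_0$ is a center), and let $\mathcal{P}_{z_0}$ be the period annulus of the center $z_0$ of $\nabla H_f^\perp$. Then (i) $f$ is injective in $\overline{\mathcal{P}_{z_0}}$, where $\overline{\mathcal{P}_{z_0}}$ is the closure of $\mathcal{P}_{z_0}$ in $U$; and (ii) $f(\mathcal{P}_{z_0})=\mathbb{R}^2$ or $f(\mathcal{P}_{z_0})$ is an open disc centered at $(0,0)$.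
   Context: Let $\mathcal{X}$ be a $C^1$ vector field on an open connected set $U\subset\mathbb{R}^2$. An isolated singular point (zero) $z_0$ of $\mathcal{X}$ is a center if there is a neighborhood $V\subset U$ of $z_0$ such that every orbit of $\mathcal{X}$ in $V\setminus\{z_0\}$ is periodic (non-constant). The period annulus $\mathcal{P}_{z_0}$ of a center $z_0$ is the maximal open connected set $W\subset U$ containing $z_0$ such that $W\setminus\{z_0\}$ is filled with (i.e. is a union of) periodic orbits of $\mathcal{X}$. *)

theory Defs
  imports "HOL-Analysis.Analysis"
begin

definition C1_on :: "'a::real_normed_vector set \<Rightarrow> ('a \<Rightarrow> 'b::real_normed_vector) \<Rightarrow> bool" where
  "C1_on U f \<longleftrightarrow> (\<exists>f' :: 'a \<Rightarrow> 'a \<Rightarrow>\<^sub>L 'b.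
     (\<forall>x\<in>U. (f has_derivative blinfun_apply (f' x)) (at x)) \<and> continuous_on U f')"

definition C2_on :: "'a::real_normed_vector set \<Rightarrow> ('a \<Rightarrow> 'b::real_normed_vector) \<Rightarrow> bool" where
  "C2_on U f \<longleftrightarrow> (\<exists>f' :: 'a \<Rightarrow> 'a \<Rightarrow>\<^sub>L 'b.
     (\<forall>x\<in>U. (f has_derivative blinfun_apply (f' x)) (at x)) \<and> C1_on U f')"

text \<open>Images of non-constant periodic solutions of \<open>x' = X x\<close> in \<open>U\<close>. Such a solution is defined
  for all times, hence it is a maximal solution and its image is a full orbit.\<close>

definition periodic_orbit ::
  "('a::real_normed_vector \<Rightarrow> 'a) \<Rightarrow> 'a set \<Rightarrow> 'a set \<Rightarrow> bool" where
  "periodic_orbit X U C \<longleftrightarrow> (\<exists>(x :: real \<Rightarrow> 'a) T.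
     (\<forall>t. x t \<in> U \<and> (x has_vector_derivative X (x t)) (at t)) \<and>
     T > 0 \<and> (\<forall>t. x (t + T) = x t) \<and> (\<exists>s t. x s \<noteq> x t) \<and> C = range x)"

definition filled_with_periodic_orbits ::
  "('a::real_normed_vector \<Rightarrow> 'a) \<Rightarrow> 'a set \<Rightarrow> 'a set \<Rightarrow> bool" where
  "filled_with_periodic_orbits X U S \<longleftrightarrow> (\<exists>\<C>. (\<forall>C\<in>\<C>. periodic_orbit X U C) \<and> S = \<Union>\<C>)"

definition isolated_zero :: "('a::real_normed_vector \<Rightarrow> 'a) \<Rightarrow> 'a set \<Rightarrow> 'a \<Rightarrow> bool" where
  "isolated_zero X U z0 \<longleftrightarrow> z0 \<in> U \<and> X z0 = 0 \<and>
     (\<exists>V. open V \<and> z0 \<in> V \<and> V \<subseteq> U \<and> (\<forall>z\<in>V - {z0}. X z \<noteq> 0))"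

text \<open>The orbits in \<open>V - {z0}\<close> are understood as the maximal solutions of the field restricted to
  \<open>V - {z0}\<close>. For a \<open>C\<^sup>1\<close> field they are all periodic precisely when
  \<open>V - {z0}\<close> is a union of periodic orbits.\<close>

definition is_center :: "('a::real_normed_vector \<Rightarrow> 'a) \<Rightarrow> 'a set \<Rightarrow> 'a \<Rightarrow> bool" where
  "is_center X U z0 \<longleftrightarrow> isolated_zero X U z0 \<and>
     (\<exists>V. open V \<and> z0 \<in> V \<and> V \<subseteq> U \<and> filled_with_periodic_orbits X U (V - {z0}))"

definition annular_region ::
  "('a::real_normed_vector \<Rightarrow> 'a) \<Rightarrow> 'a set \<Rightarrow> 'a \<Rightarrow> 'a set \<Rightarrow> bool" where
  "annular_region X U z0 W \<longleftrightarrow> open W \<and> connected W \<and> W \<subseteq> U \<and> z0 \<in> W \<and>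
     filled_with_periodic_orbits X U (W - {z0})"

definition period_annulus ::
  "('a::real_normed_vector \<Rightarrow> 'a) \<Rightarrow> 'a set \<Rightarrow> 'a \<Rightarrow> 'a set" where
  "period_annulus X U z0 = (GREATEST W. annular_region X U z0 W)"

text \<open>The greatest such region exists as soon as there is one, since these regions are closed under
  unions.\<close>

lemma filled_with_periodic_orbits_Union:
  assumes "\<And>S. S \<in> \<S> \<Longrightarrow> filled_with_periodic_orbits X U S"
  shows "filled_with_periodic_orbits X U (\<Union>\<S>)"
proof -
  let ?\<C> = "{C. periodic_orbit X U C \<and> C \<subseteq> \<Union>\<S>}"
  have "z \<in> \<Union>?\<C>" if "S \<in> \<S>" "z \<in> S" for S z
  proof -
    from assms[OF \<open>S \<in> \<S>\<close>] obtain \<C> where \<C>: "\<forall>C\<in>\<C>. periodic_orbit X U C" "S = \<Union>\<C>"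
      unfolding filled_with_periodic_orbits_def by blast
    with \<open>z \<in> S\<close> obtain C where "C \<in> \<C>" "z \<in> C"
      by blast
    moreover from this \<C> have "C \<subseteq> S"
      by blast
    ultimately show ?thesis
      using \<C>(1) \<open>S \<in> \<S>\<close> by blast
  qed
  then have "\<Union>\<S> = \<Union>?\<C>"
    by blast
  then show ?thesis
    unfolding filled_with_periodic_orbits_def by (intro exI[of _ "?\<C>"]) simp
qed

lemma annular_region_Union:
  assumes "\<W> \<noteq> {}" and W: "\<And>W. W \<in> \<W> \<Longrightarrow> annular_region X U z0 W"
  shows "annular_region X U z0 (\<Union>\<W>)"
proof -
  have "filled_with_periodic_orbits X U (\<Union>((\<lambda>W. W - {z0}) ` \<W>))"
    using W by (intro filled_with_periodic_orbits_Union) (auto simp: annular_region_def)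
  moreover have "\<Union>((\<lambda>W. W - {z0}) ` \<W>) = \<Union>\<W> - {z0}"
    by auto
  moreover have "connected (\<Union>\<W>)"
    using assms by (intro connected_Union) (auto simp: annular_region_def)
  ultimately show ?thesis
    using assms by (auto simp: annular_region_def)
qed

lemma period_annulus:
  assumes "annular_region X U z0 W"
  shows "annular_region X U z0 (period_annulus X U z0)"
    and "W \<subseteq> period_annulus X U z0"
proof -
  have *: "annular_region X U z0 (\<Union>(Collect (annular_region X U z0)))"
    using assms by (intro annular_region_Union) auto
  have "period_annulus X U z0 = \<Union>(Collect (annular_region X U z0))"
    unfolding period_annulus_def using * by (intro Greatest_equality) auto
  with * assms show "annular_region X U z0 (period_annulus X U z0)"
    and "W \<subseteq> period_annulus X U z0" by auto
qed

definition half_norm_sq :: "(real^2 \<Rightarrow> real^2) \<Rightarrow> real^2 \<Rightarrow> real" where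
  "half_norm_sq f z = ((f z $ 1)\<^sup>2 + (f z $ 2)\<^sup>2) / 2"

definition partial_deriv :: "2 \<Rightarrow> (real^2 \<Rightarrow> real) \<Rightarrow> real^2 \<Rightarrow> real" where
  "partial_deriv i H z = frechet_derivative H (at z) (axis i 1)"

definition hamiltonian_field :: "(real^2 \<Rightarrow> real) \<Rightarrow> real^2 \<Rightarrow> real^2" where
  "hamiltonian_field H z = vector [- partial_deriv 2 H z, partial_deriv 1 H z]"

end

theory Submission
  imports Defs
begin

text \<open>Along the field, \<open>w = f z\<close> satisfies \<open>w' = det (Df z) J w\<close> with \<open>J\<close> the quarter turn, so orbits are
  lifts under the local homeomorphism \<open>f\<close> of motions along circles centred at the origin. Let
  \<open>W\<close> be the image of the maximal disc on which the local inverse of \<open>f\<close> with \<open>0 \<mapsto> z0\<close> is defined.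
  Two inverse branches that meet agree on convex intersections of their domains, whence \<open>f\<close> is
  injective on the closure of \<open>W\<close> in \<open>U\<close>. The lifted circles fill \<open>W - {z0}\<close>, so \<open>W\<close> is contained in the
  period annulus. Conversely, were the period annulus larger, it would contain a periodic orbit
  through a frontier point of \<open>W\<close>; this orbit stays in the closure of \<open>W\<close> and covers the whole
  boundary circle, so the inverse branch would extend to the closed disc and then, by compactness,
  to a larger disc.\<close>

subsection \<open>Inverse branches of a local homeomorphism over discs\<close>

text \<open>Continuity and local injectivity drive the whole covering argument: invariance of domain
  turns them into continuous local inverses, in any Euclidean space.\<close>

locale local_inversion =
  fixes f :: "'a::euclidean_space \<Rightarrow> 'a" and U :: "'a set" and z0 :: 'a
  assumes open_U: "open U" and cont_f: "continuous_on U f"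
    and locally_inj: "p \<in> U \<Longrightarrow> \<exists>N. open N \<and> p \<in> N \<and> N \<subseteq> U \<and> inj_on f N"
    and z0_in_U: "z0 \<in> U" and f_z0: "f z0 = 0"
begin

text \<open>The domain of an inverse branch of \<open>f\<close>. Convex images are required because
  two of them have a connected intersection, over which lifts are unique.\<close>

definition sheet :: "'a set \<Rightarrow> bool" where
  "sheet V \<longleftrightarrow> open V \<and> V \<subseteq> U \<and> inj_on f V \<and> convex (f ` V)"

text \<open>Since \<open>z0\<close> lies in \<open>V\<close> and \<open>f z0 = 0\<close>, the radius
  \<open>r\<close> is automatically positive.\<close>

definition disc_sheet :: "real \<Rightarrow> 'a set \<Rightarrow> bool" where
  "disc_sheet r V \<longleftrightarrow> sheet V \<and> z0 \<in> V \<and> f ` V = ball 0 r"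

definition max_sheet :: "'a set" where
  "max_sheet = \<Union>{V. \<exists>r. disc_sheet r V}"

section \<open>Charts and uniqueness of lifts\<close>

lemma open_image:
  assumes "open S" "S \<subseteq> U"
  shows "open (f ` S)"
proof (subst open_subopen, clarify)
  fix p assume "p \<in> S"
  then obtain N where N: "open N" "p \<in> N" "N \<subseteq> U" "inj_on f N"
    using locally_inj assms by blast
  have "open (f ` (S \<inter> N))"
    using N assms by (intro invariance_of_domain) (auto intro: continuous_on_subset[OF cont_f] inj_on_subset)
  then show "\<exists>T. open T \<and> f p \<in> T \<and> T \<subseteq> f ` S"
    using \<open>p \<in> S\<close> \<open>p \<in> N\<close> by (intro exI[of _ "f ` (S \<inter> N)"]) auto
qed

text \<open>Cutting an injective neighbourhood down to the preimage of a small ball makes its image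
  convex, so every point has arbitrarily small sheets.\<close>

lemma ball_chart:
  assumes "p \<in> U" "open Q" "p \<in> Q"
  obtains N d where "sheet N" "p \<in> N" "N \<subseteq> Q" "d > 0" "f ` N = ball (f p) d"
proof -
  obtain N0 where N0: "open N0" "p \<in> N0" "N0 \<subseteq> U" "inj_on f N0"
    using locally_inj assms by blast
  have "open (f ` (N0 \<inter> Q))"
    using N0 assms by (intro open_image) auto
  then obtain d where d: "d > 0" "ball (f p) d \<subseteq> f ` (N0 \<inter> Q)"
    using N0 assms by (metis IntI imageI openE)
  define N where "N = (N0 \<inter> Q) \<inter> f -` ball (f p) d"
  have img: "f ` N = ball (f p) d"
    using d by (auto simp: N_def)
  have "open N"
    unfolding N_def using N0 assms
    by (intro continuous_open_preimage) (auto intro: continuous_on_subset[OF cont_f])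
  with N0 have "sheet N"
    unfolding sheet_def img by (auto simp: N_def intro: inj_on_subset)
  then show thesis
    using that[of N d] img d N0 assms by (auto simp: N_def)
qed

text \<open>The coincidence set of two lifts is closed by continuity. It is open because near a
  coincidence both lifts stay in one set on which \<open>f\<close> is injective.\<close>

lemma lift_unique:
  assumes "connected S" "continuous_on S g" "continuous_on S h" "g ` S \<subseteq> U" "h ` S \<subseteq> U"
    and eq: "\<And>w. w \<in> S \<Longrightarrow> f (g w) = f (h w)"
    and "w0 \<in> S" "g w0 = h w0" "w \<in> S"
  shows "g w = h w"
proof -
  let ?E = "{w \<in> S. g w = h w}"
  have "closedin (top_of_set S) {w \<in> S. g w - h w = 0}"
    using assms by (intro continuous_closedin_preimage_constant continuous_intros)
  then have cl: "closedin (top_of_set S) ?E"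
    by simp
  have op: "openin (top_of_set S) ?E"
  proof (subst openin_subopen, clarify)
    fix v assume v: "v \<in> S" "g v = h v"
    then obtain N where N: "open N" "g v \<in> N" "inj_on f N"
      using locally_inj assms(4) by blast
    have "openin (top_of_set S) ((S \<inter> g -` N) \<inter> (S \<inter> h -` N))"
      using N assms by (intro openin_Int continuous_openin_preimage_gen)
    moreover have "(S \<inter> g -` N) \<inter> (S \<inter> h -` N) \<subseteq> ?E"
      using N eq by (auto dest: inj_onD)
    ultimately show "\<exists>T. openin (top_of_set S) T \<and> v \<in> T \<and> T \<subseteq> ?E"
      using v N by (intro exI[of _ "(S \<inter> g -` N) \<inter> (S \<inter> h -` N)"]) auto
  qed
  from cl op assms show ?thesis
    unfolding connected_clopen by blast
qed

text \<open>The inverses of \<open>f\<close> on \<open>V\<close> and on \<open>N\<close> both lift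
  the identity over the convex set \<open>f\<close> V \<inter> f \<open>N\<close>, and they coincide
  at \<open>f p\<close>.\<close>

lemma sheets_agree:
  assumes V: "sheet V" and N: "sheet N" and "p \<in> V \<inter> N"
    and "x \<in> V" "y \<in> N" "f x = f y"
  shows "x = y"
proof -
  obtain g where g: "homeomorphism V (f ` V) f g"
    using V invariance_of_domain_homeomorphism[of V f] continuous_on_subset[OF cont_f]
    unfolding sheet_def by blast
  obtain h where h: "homeomorphism N (f ` N) f h"
    using N invariance_of_domain_homeomorphism[of N f] continuous_on_subset[OF cont_f]
    unfolding sheet_def by blast
  have "g (f x) = h (f x)"
  proof (rule lift_unique[of "f ` V \<inter> f ` N" g h "f p"])
    show "connected (f ` V \<inter> f ` N)"
      using V N unfolding sheet_def by (intro convex_connected convex_Int) auto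
    show "continuous_on (f ` V \<inter> f ` N) g" "continuous_on (f ` V \<inter> f ` N) h"
      using g h by (auto simp: homeomorphism_def intro: continuous_on_subset)
    show "g ` (f ` V \<inter> f ` N) \<subseteq> U" "h ` (f ` V \<inter> f ` N) \<subseteq> U"
      using V N homeomorphism_apply1[OF g] homeomorphism_apply1[OF h]
      unfolding sheet_def by fastforce+
    show "f (g w) = f (h w)" if "w \<in> f ` V \<inter> f ` N" for w
      using that homeomorphism_apply2[OF g] homeomorphism_apply2[OF h] by auto
    show "g (f p) = h (f p)"
      using assms homeomorphism_apply1[OF g] homeomorphism_apply1[OF h] by auto
    show "f x \<in> f ` V \<inter> f ` N"
      using assms by (metis IntI imageI)
  qed (use assms in auto)
  then show ?thesis
    unfolding homeomorphism_apply1[OF g \<open>x \<in> V\<close>]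
    unfolding \<open>f x = f y\<close> homeomorphism_apply1[OF h \<open>y \<in> N\<close>] .
qed

section \<open>The maximal sheet over a disc centred at the origin\<close>

lemma disc_sheet_exists: "\<exists>r>0. \<exists>V. disc_sheet r V"
proof -
  obtain N d where "sheet N" "z0 \<in> N" "d > 0" "f ` N = ball (f z0) d"
    using ball_chart[OF z0_in_U open_U z0_in_U] .
  then show ?thesis
    unfolding disc_sheet_def f_z0 by blast
qed

text \<open>The image is a union of concentric balls: the ball whose radius is the supremum of the
  radii if these are bounded, the whole space otherwise.\<close>

lemma f_max_sheet: "f ` max_sheet = UNIV \<or> (\<exists>R>0. f ` max_sheet = ball 0 R)"
proof -
  define S where "S = {r. \<exists>V. disc_sheet r V}"
  have img: "f ` max_sheet = (\<Union>r\<in>S. ball 0 r)"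
    by (auto simp: max_sheet_def S_def image_Union disc_sheet_def)
  obtain r0 where r0: "r0 \<in> S" "r0 > 0"
    using disc_sheet_exists S_def by blast
  show ?thesis
  proof (cases "bdd_above S")
    case True
    have "f ` max_sheet = ball 0 (Sup S)"
    proof -
      have "norm w < Sup S \<longleftrightarrow> (\<exists>r\<in>S. norm w < r)" for w :: 'a
        using True r0 by (subst less_cSup_iff) auto
      then show ?thesis
        unfolding img by auto
    qed
    moreover have "Sup S > 0"
      using cSup_upper[OF r0(1) True] r0(2) by linarith
    ultimately show ?thesis by blast
  next
    case False
    then have "f ` max_sheet = UNIV"
      unfolding img bdd_above_def by (auto simp: not_le)
    then show ?thesis ..
  qed
qed

lemma disc_sheet_subset_max_sheet: "disc_sheet r V \<Longrightarrow> V \<subseteq> max_sheet"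
  by (auto simp: max_sheet_def)

lemma z0_in_max_sheet: "z0 \<in> max_sheet"
  using disc_sheet_exists disc_sheet_subset_max_sheet disc_sheet_def by blast

text \<open>Any two disc sheets share \<open>z0\<close>, so their inverse branches agree and
  injectivity passes to the union.\<close>

lemma sheet_max_sheet: "sheet max_sheet"
proof -
  have "inj_on f max_sheet"
  proof (rule inj_onI)
    fix x y assume "x \<in> max_sheet" "y \<in> max_sheet" and eq: "f x = f y"
    then obtain r V s V' where *: "disc_sheet r V" "x \<in> V" "disc_sheet s V'" "y \<in> V'"
      unfolding max_sheet_def by blast
    then show "x = y"
      using sheets_agree[of V V' z0 x y] eq by (auto simp: disc_sheet_def)
  qed
  moreover have "open max_sheet" "max_sheet \<subseteq> U"
    by (auto simp: max_sheet_def disc_sheet_def sheet_def)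
  moreover have "convex (f ` max_sheet)"
    using f_max_sheet by auto
  ultimately show ?thesis
    unfolding sheet_def by blast
qed

lemma connected_max_sheet: "connected max_sheet"
proof -
  obtain g where g: "homeomorphism max_sheet (f ` max_sheet) f g"
    using sheet_max_sheet invariance_of_domain_homeomorphism[of max_sheet f]
      continuous_on_subset[OF cont_f]
    unfolding sheet_def by blast
  have "connected (g ` (f ` max_sheet))"
    using g sheet_max_sheet
    by (intro connected_continuous_image convex_connected) (auto simp: homeomorphism_def sheet_def)
  then show ?thesis
    using g by (simp add: homeomorphism_def)
qed

section \<open>Boundary behaviour of the maximal sheet and maximality of its radius\<close>

lemma f_closure_max_sheet:
  assumes "p \<in> closure max_sheet \<inter> U"
  shows "f p \<in> closure (f ` max_sheet)"
proof -
  have "p \<in> U" using assms by simp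
  show ?thesis
  proof (rule ccontr)
    let ?T = "- closure (f ` max_sheet)"
    assume "f p \<notin> closure (f ` max_sheet)"
    moreover have "open (U \<inter> f -` ?T)"
      using open_U cont_f by (intro continuous_open_preimage) auto
    ultimately have "(U \<inter> f -` ?T) \<inter> max_sheet \<noteq> {}"
      using assms open_Int_closure_eq_empty[of "U \<inter> f -` ?T" max_sheet] by auto
    then show False
      using closure_subset[of "f ` max_sheet"] by auto
  qed
qed

text \<open>A sheet around a point of the closure is open, hence meets \<open>max_sheet\<close>;
  from then on both carry the same inverse branch over their common image.\<close>

lemma chart_agrees:
  assumes "sheet N" "p \<in> N" "p \<in> closure max_sheet" "x \<in> max_sheet" "f x \<in> f ` N"
  shows "x \<in> N"
proof -
  obtain q where "q \<in> max_sheet \<inter> N"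
    using assms(1-3) open_Int_closure_eq_empty[of N max_sheet] unfolding sheet_def by blast
  moreover obtain y where "y \<in> N" "f x = f y"
    using assms by auto
  ultimately show ?thesis
    using sheets_agree[OF sheet_max_sheet assms(1)] assms by blast
qed

text \<open>Disjoint charts at two points with the same image would both have to contain the one
  point of \<open>max_sheet\<close> over a suitable nearby value.\<close>

lemma inj_on_closure_max_sheet: "inj_on f (closure max_sheet \<inter> U)"
proof (rule inj_onI, rule ccontr)
  fix p q assume p: "p \<in> closure max_sheet \<inter> U" and q: "q \<in> closure max_sheet \<inter> U"
    and eq: "f p = f q" and "p \<noteq> q"
  obtain A B where AB: "open A" "open B" "p \<in> A" "q \<in> B" "A \<inter> B = {}"
    using separation_t2 \<open>p \<noteq> q\<close> by metis
  obtain N d where N: "sheet N" "p \<in> N" "N \<subseteq> A" "d > 0" "f ` N = ball (f p) d"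
    using ball_chart AB p by blast
  obtain M e where M: "sheet M" "q \<in> M" "M \<subseteq> B" "e > 0" "f ` M = ball (f q) e"
    using ball_chart AB q by blast
  \<comment> \<open>A value taken on \<open>max_sheet\<close> so close to \<open>f p = f q\<close>
    that it lies in both image balls.\<close>
  obtain w where w: "w \<in> f ` max_sheet" "dist (f p) w < min d e"
  proof -
    have "min d e > 0" using N M by simp
    then show thesis
      using f_closure_max_sheet[OF p] that unfolding closure_approachable dist_commute[of "f p"]
      by blast
  qed
  then obtain x where x: "x \<in> max_sheet" "w = f x" by auto
  have "p \<in> closure max_sheet" "q \<in> closure max_sheet"
    using p q by blast+
  moreover have "f x \<in> f ` N" "f x \<in> f ` M"
    unfolding N(5) M(5) using w(2) x(2) eq by simp_all
  ultimately have "x \<in> N" "x \<in> M"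
    using chart_agrees N(1,2) M(1,2) x(1) by blast+
  then show False
    using N(3) M(3) AB(5) by blast
qed

lemma closure_max_sheet_nbhd:
  assumes p: "p \<in> closure max_sheet \<inter> U"
  obtains N d where "sheet N" "p \<in> N" "d > 0" "f ` N = ball (f p) d"
    "\<And>q. \<lbrakk>q \<in> N; f q \<in> closure (f ` max_sheet)\<rbrakk> \<Longrightarrow> q \<in> closure max_sheet"
proof -
  obtain N d where N: "sheet N" "p \<in> N" "d > 0" "f ` N = ball (f p) d"
    using ball_chart[OF IntD2[OF p] open_U IntD2[OF p]] by metis
  have "q \<in> closure max_sheet" if q: "q \<in> N" "f q \<in> closure (f ` max_sheet)" for q
  proof (rule ccontr)
    define T where "T = N - closure max_sheet"
    assume "q \<notin> closure max_sheet"
    then have "f q \<in> f ` T"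
      using q by (auto simp: T_def)
    moreover have "open (f ` T)"
      unfolding T_def using N by (intro open_image) (auto simp: sheet_def)
    ultimately have "\<exists>w. w \<in> f ` T \<inter> f ` max_sheet"
      using q(2) open_Int_closure_eq_empty[of "f ` T" "f ` max_sheet"] by blast
    then obtain x y where xy: "x \<in> max_sheet" "y \<in> T" "f x = f y"
      by force
    then have "y \<in> N" "y \<notin> closure max_sheet"
      by (simp_all add: T_def)
    then have "x \<in> N"
      using chart_agrees[OF N(1,2)] p xy by blast
    then have "x = y"
      using xy N(1) \<open>y \<in> N\<close> unfolding sheet_def by (blast dest: inj_onD)
    then show False
      using xy closure_subset[of max_sheet] \<open>y \<notin> closure max_sheet\<close> by blast
  qed
  then show thesis
    using that N by blast
qed

text \<open>Every pair in \<open>K \<times> K\<close> has a neighbourhood of pairs violating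
  nothing: on the diagonal by local injectivity, off it by separating the two images. Compactness
  makes the size of these neighbourhoods uniform.\<close>

lemma inj_on_neighbourhood_of_compact:
  assumes K: "compact K" "K \<subseteq> U" "inj_on f K"
  obtains N where "open N" "K \<subseteq> N" "N \<subseteq> U" "inj_on f N"
proof -
  \<comment> \<open>The interior of the set of pairs in \<open>U \<times> U\<close> at which
    injectivity does not fail.\<close>
  define O' where "O' = \<Union>{T. open T \<and> (\<forall>(a, b)\<in>T. a \<in> U \<and> b \<in> U \<and> (f a = f b \<longrightarrow> a = b))}"
  have "open O'"
    by (auto simp: O'_def)
  have sub: "K \<times> K \<subseteq> O'"
  proof clarify
    fix a b assume ab: "a \<in> K" "b \<in> K"
    then have abU: "a \<in> U" "b \<in> U" using K by auto
    show "(a, b) \<in> O'"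
    proof (cases "a = b")
      case True
      obtain N where "open N" "a \<in> N" "N \<subseteq> U" "inj_on f N"
        using locally_inj abU by blast
      then show ?thesis
        unfolding O'_def using True
        by (intro UnionI[of "N \<times> N"]) (auto intro: open_Times dest: inj_onD)
    next
      case False
      then have "f a \<noteq> f b"
        using K ab by (auto dest: inj_onD)
      then obtain A B where AB: "open A" "open B" "f a \<in> A" "f b \<in> B" "A \<inter> B = {}"
        using separation_t2 by metis
      have "open (U \<inter> f -` A)" "open (U \<inter> f -` B)"
        using AB open_U cont_f by (auto intro: continuous_open_preimage)
      then show ?thesis
        unfolding O'_def using AB abU
        by (intro UnionI[of "(U \<inter> f -` A) \<times> (U \<inter> f -` B)"]) (auto intro!: open_Times)
    qed
  qed
  obtain e where e: "e > 0" "(\<Union>x\<in>K \<times> K. ball x e) \<subseteq> O'"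
    using compact_subset_open_imp_ball_epsilon_subset[OF compact_Times[OF K(1) K(1)] \<open>open O'\<close> sub]
    by blast
  \<comment> \<open>Two deviations below \<open>e/2\<close> add up to less than \<open>e\<close> in
    the product.\<close>
  define N where "N = (\<Union>x\<in>K. ball x (e/2))"
  have pair: "(a, b) \<in> O'" if ab: "a \<in> N" "b \<in> N" for a b
  proof -
    obtain x y where "x \<in> K" "y \<in> K" "dist x a < e/2" "dist y b < e/2"
      using ab by (auto simp: N_def)
    moreover have "dist (x, y) (a, b) \<le> dist x a + dist y b"
      by (simp add: dist_Pair_Pair sqrt_sum_squares_le_sum)
    ultimately show ?thesis
      using e by force
  qed
  show thesis
  proof
    show "open N" "K \<subseteq> N" using e by (auto simp: N_def)
    show "N \<subseteq> U" "inj_on f N"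
      using pair by (fastforce simp: O'_def inj_on_def)+
  qed
qed

text \<open>This is where maximality of the radius enters: an inverse \<open>k\<close> over the
  closed disc would have a compact image, and injectivity near that image would yield a disc sheet
  of radius larger than \<open>R\<close>.\<close>

lemma closed_disc_not_covered:
  assumes R: "f ` max_sheet = ball 0 R" "R > 0"
  shows "\<not> cball 0 R \<subseteq> f ` (closure max_sheet \<inter> U)"
proof
  assume cov: "cball 0 R \<subseteq> f ` (closure max_sheet \<inter> U)"
  have "\<exists>k. \<forall>w\<in>cball 0 R. k w \<in> closure max_sheet \<inter> U \<and> f (k w) = w"
    by (intro bchoice ballI) (use cov in blast)
  then obtain k where k: "\<And>w. w \<in> cball 0 R \<Longrightarrow> k w \<in> closure max_sheet \<inter> U"
      "\<And>w. w \<in> cball 0 R \<Longrightarrow> f (k w) = w"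
    by blast
  have clD: "closure (f ` max_sheet) = cball 0 R"
    using R by simp
  have "continuous_on (cball 0 R) k"
    unfolding continuous_on_topological
  proof (intro ballI allI impI)
    fix w B assume w: "w \<in> cball 0 R" "open B" "k w \<in> B"
    obtain N d where N: "sheet N" "k w \<in> N" "d > 0" "f ` N = ball (f (k w)) d"
      "\<And>q. \<lbrakk>q \<in> N; f q \<in> closure (f ` max_sheet)\<rbrakk> \<Longrightarrow> q \<in> closure max_sheet"
      using closure_max_sheet_nbhd[OF k(1)[OF w(1)]] by blast
    have "open (f ` (N \<inter> B))"
      using N w by (intro open_image) (auto simp: sheet_def)
    moreover have "w \<in> f ` (N \<inter> B)"
      using k(2)[OF w(1)] w(3) N(2) by (intro image_eqI[of _ _ "k w"]) auto
    \<comment> \<open>The chart point over \<open>v\<close> lies in the closure of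
      \<open>max_sheet\<close>, where \<open>f\<close> is injective, so it must be
      \<open>k v\<close>.\<close>
    moreover have "k v \<in> B" if v: "v \<in> cball 0 R" "v \<in> f ` (N \<inter> B)" for v
    proof -
      obtain q where q: "q \<in> N" "q \<in> B" "f q = v"
        using v by auto
      then have "q \<in> closure max_sheet \<inter> U"
        using N(1,5) v clD by (auto simp: sheet_def)
      then have "k v = q"
        using inj_onD[OF inj_on_closure_max_sheet] k[OF v(1)] q(3) by simp
      then show ?thesis using q by simp
    qed
    ultimately show "\<exists>A. open A \<and> w \<in> A \<and> (\<forall>y\<in>cball 0 R. y \<in> A \<longrightarrow> k y \<in> B)"
      by blast
  qed
  then have "compact (k ` cball 0 R)"
    by (intro compact_continuous_image) auto
  moreover have "k ` cball 0 R \<subseteq> U" "inj_on f (k ` cball 0 R)"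
    using k by (auto simp: inj_on_def)
  ultimately obtain N where N: "open N" "k ` cball 0 R \<subseteq> N" "N \<subseteq> U" "inj_on f N"
    using inj_on_neighbourhood_of_compact by blast
  have "cball 0 R \<subseteq> f ` N"
  proof
    fix w :: 'a assume w: "w \<in> cball 0 R"
    then have "k w \<in> N" using N(2) by blast
    then show "w \<in> f ` N" using k(2)[OF w] by (metis image_eqI)
  qed
  moreover have "open (f ` N)"
    using N by (intro open_image)
  ultimately obtain e where e: "e > 0" "(\<Union>x\<in>cball 0 R. ball x e) \<subseteq> f ` N"
    using compact_subset_open_imp_ball_epsilon_subset[OF compact_cball] by metis
  have big: "ball 0 (R + e/2) \<subseteq> f ` N"
  proof
    fix w :: 'a assume w: "w \<in> ball 0 (R + e/2)"
    show "w \<in> f ` N"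
    proof (cases "norm w \<le> R")
      case True
      then show ?thesis using \<open>cball 0 R \<subseteq> f ` N\<close> by auto
    next
      case False
      \<comment> \<open>Radial projection of \<open>w\<close> to the sphere of radius
        \<open>R\<close>; it is at distance \<open>norm w - R < e/2\<close> from
        \<open>w\<close>.\<close>
      define v where "v = (R / norm w) *\<^sub>R w"
      have nw: "norm w > R" "norm w > 0" using False R by auto
      have "norm v = R"
        using R nw by (simp add: v_def)
      moreover have "w - v = (1 - R / norm w) *\<^sub>R w"
        by (simp add: v_def algebra_simps)
      then have "norm (w - v) = \<bar>1 - R / norm w\<bar> * norm w"
        by simp
      then have "norm (w - v) = norm w - R"
        using nw R by (simp add: left_diff_distrib)
      then have "dist v w < e"
        using w e by (simp add: dist_norm norm_minus_commute)
      ultimately show ?thesis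
        using e(2) by force
    qed
  qed
  define M where "M = N \<inter> f -` ball 0 (R + e/2)"
  have img: "f ` M = ball 0 (R + e/2)"
    using big by (auto simp: M_def)
  \<comment> \<open>Ensures that the enlarged branch still passes through the base point.\<close>
  have z0: "k 0 = z0"
  proof (rule inj_onD[OF inj_on_closure_max_sheet])
    show "f (k 0) = f z0" "k 0 \<in> closure max_sheet \<inter> U"
      using k[of 0] R(2) f_z0 by simp_all
    show "z0 \<in> closure max_sheet \<inter> U"
      using z0_in_max_sheet z0_in_U closure_subset[of max_sheet] by blast
  qed
  have "open M"
    unfolding M_def using N
    by (intro continuous_open_preimage) (auto intro: continuous_on_subset[OF cont_f])
  moreover have "z0 \<in> M"
  proof -
    have "k 0 \<in> N" using N(2) R by auto
    then show ?thesis using z0 f_z0 R e by (auto simp: M_def)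
  qed
  ultimately have "disc_sheet (R + e/2) M"
    using N img unfolding disc_sheet_def sheet_def by (auto simp: M_def intro: inj_on_subset)
  then have "M \<subseteq> max_sheet"
    by (rule disc_sheet_subset_max_sheet)
  then have "f ` M \<subseteq> ball 0 R"
    using R by auto
  then have "ball (0::'a) (R + e/2) \<subseteq> ball 0 R"
    using img by simp
  then show False
    using e(1) R(2) by (simp add: ball_subset_ball_iff)
qed

text \<open>The times spent in the closure form a clopen set: as the curve lies over the boundary
  sphere, staying in a chart means staying in the closure. Hence the closure would cover the whole
  closed disc.\<close>

lemma no_closed_curve_at_boundary:
  fixes x :: "real \<Rightarrow> 'a"
  assumes R: "f ` max_sheet = ball 0 R" "R > 0"
    and x: "continuous_on UNIV x" "range x \<subseteq> U" "x t0 \<in> closure max_sheet"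
    and circ: "f ` range x = sphere 0 R"
  shows False
proof -
  have clD: "closure (f ` max_sheet) = cball 0 R"
    using R by simp
  have "closed (x -` closure max_sheet)"
    using x by (intro closed_vimage) auto
  moreover have "open (x -` closure max_sheet)"
  proof (subst open_subopen, clarify)
    fix t assume "x t \<in> closure max_sheet"
    then have "x t \<in> closure max_sheet \<inter> U" using x by auto
    then obtain N d where N: "sheet N" "x t \<in> N" "d > 0" "f ` N = ball (f (x t)) d"
      "\<And>q. \<lbrakk>q \<in> N; f q \<in> closure (f ` max_sheet)\<rbrakk> \<Longrightarrow> q \<in> closure max_sheet"
      using closure_max_sheet_nbhd by metis
    have "f (x s) \<in> cball 0 R" for s
      using circ by (metis image_eqI in_mono rangeI sphere_cball)
    then have "x -` N \<subseteq> x -` closure max_sheet"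
      using N(5) clD by auto
    moreover have "open (x -` N)"
      using N x by (intro open_vimage) (auto simp: sheet_def)
    ultimately show "\<exists>T. open T \<and> t \<in> T \<and> T \<subseteq> x -` closure max_sheet"
      using N by blast
  qed
  ultimately have "x -` closure max_sheet = UNIV"
    using x(3) clopen[of "x -` closure max_sheet"] by auto
  then have "range x \<subseteq> closure max_sheet \<inter> U"
    using x by auto
  then have "sphere 0 R \<subseteq> f ` (closure max_sheet \<inter> U)"
    unfolding circ[symmetric] by (rule image_mono)
  moreover have "ball 0 R \<subseteq> f ` (closure max_sheet \<inter> U)"
    using R closure_subset[of max_sheet] sheet_max_sheet unfolding sheet_def
    by (metis Int_greatest image_mono)
  moreover have "cball (0::'a) R \<subseteq> sphere 0 R \<union> ball 0 R"
    by auto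
  ultimately have "cball 0 R \<subseteq> f ` (closure max_sheet \<inter> U)"
    by blast
  then show False
    using closed_disc_not_covered[OF R] by blast
qed

text \<open>Injectivity on the closure keeps \<open>f p\<close> out of the open image, while
  continuity keeps it in the closed one; this also excludes the image being everything.\<close>

lemma norm_f_frontier:
  assumes "p \<in> closure max_sheet \<inter> U" "p \<notin> max_sheet"
  obtains R where "R > 0" "f ` max_sheet = ball 0 R" "norm (f p) = R"
proof -
  have "f p \<notin> f ` max_sheet"
    using assms inj_on_closure_max_sheet sheet_max_sheet closure_subset[of max_sheet]
    unfolding sheet_def by (auto dest: inj_onD)
  moreover have "f p \<in> closure (f ` max_sheet)"
    using f_closure_max_sheet assms by blast
  ultimately show thesis
    using f_max_sheet that by (auto simp: not_less)
qed

end

subsection \<open>Periodic scalar equations and planar rotations\<close>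

text \<open>The range is an interval containing \<open>F 0 + n * K\<close> and
  \<open>F 0 - n * K\<close> for every natural \<open>n\<close>, so it is unbounded in both
  directions.\<close>

lemma quasi_periodic_surj:
  fixes F :: "real \<Rightarrow> real"
  assumes cont: "continuous_on UNIV F" and F: "\<And>t. F (t + T) = F t + K" and "K \<noteq> 0"
  shows "surj F"
proof -
  have plus: "F (t + real n * T) = F t + real n * K" for t n
  proof (induction n)
    case (Suc n)
    have "F (t + real (Suc n) * T) = F ((t + real n * T) + T)"
      by (simp add: algebra_simps)
    then show ?case
      unfolding F Suc by (simp add: algebra_simps)
  qed simp
  have minus: "F (- real n * T) = F 0 - real n * K" for n
    using plus[of "- real n * T" n] by simp
  have "y \<in> range F" for y
  proof -
    obtain n where "\<bar>y - F 0\<bar> / \<bar>K\<bar> < real n"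
      using reals_Archimedean2 by blast
    then have n: "\<bar>y - F 0\<bar> < \<bar>real n * K\<bar>"
      using \<open>K \<noteq> 0\<close> by (simp add: pos_divide_less_eq abs_mult)
    have "connected (range F)"
      using cont by (intro connected_continuous_image) auto
    moreover have "F 0 + real n * K \<in> range F" "F 0 - real n * K \<in> range F"
      using plus[of 0 n] minus[of n] by (metis rangeI)+
    ultimately show ?thesis
      using n connectedD_interval[of "range F" "F 0 - real n * K" "F 0 + real n * K" y]
        connectedD_interval[of "range F" "F 0 + real n * K" "F 0 - real n * K" y]
      by (cases "real n * K \<ge> 0") auto
  qed
  then show ?thesis by auto
qed

lemma continuous_imp_antiderivative:
  fixes h :: "real \<Rightarrow> real"
  assumes "continuous_on UNIV h"
  obtains F where "\<And>t. (F has_real_derivative h t) (at t)"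
  using einterval_antiderivative[of "-\<infinity>" "\<infinity>" h] assms
  by (auto simp: continuous_on_eq_continuous_at has_real_derivative_iff_has_vector_derivative)

text \<open>By Rolle, equal values at two points would force a zero of \<open>d\<close> between
  them.\<close>

lemma antiderivative_inj:
  fixes F d :: "real \<Rightarrow> real"
  assumes F: "\<And>t. (F has_real_derivative d t) (at t)" and nz: "\<And>t. d t \<noteq> 0"
  shows "inj F"
proof (rule injI, rule ccontr)
  fix a b assume eq: "F a = F b" and "a \<noteq> b"
  have False if "a < b" "F a = F b" for a b
  proof -
    have "\<exists>z>a. z < b \<and> DERIV F z :> 0"
      using that F
      by (intro Rolle) (auto intro!: continuous_at_imp_continuous_on simp: real_differentiable_def intro: DERIV_isCont)
    then show False
      using F nz DERIV_unique by blast
  qed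
  then show False
    using eq \<open>a \<noteq> b\<close> by (metis linorder_neqE)
qed

text \<open>The increment over one period has derivative zero, hence is constant; injectivity of
  \<open>F\<close> makes it nonzero.\<close>

lemma antiderivative_quasi_periodic:
  fixes F d :: "real \<Rightarrow> real"
  assumes F: "\<And>t. (F has_real_derivative d t) (at t)" and nz: "\<And>t. d t \<noteq> 0"
    and per: "\<And>t. d (t + T) = d t" and "T \<noteq> 0"
  obtains K where "K \<noteq> 0" "\<And>t. F (t + T) = F t + K"
proof -
  have "((\<lambda>t. F (t + T) - F t) has_real_derivative 0) (at t)" for t
  proof -
    have "((\<lambda>t. F (t + T)) has_real_derivative d (t + T)) (at t)"
      using F DERIV_shift by blast
    from DERIV_diff[OF this F[of t]] show ?thesis
      by (simp add: per)
  qed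
  then have "F (t + T) - F t = F (0 + T) - F 0" for t
    using DERIV_isconst_all[of "\<lambda>t. F (t + T) - F t"] by blast
  moreover have "F (0 + T) \<noteq> F 0"
    using antiderivative_inj[OF F nz] \<open>T \<noteq> 0\<close> by (auto dest: injD)
  ultimately show thesis
    by (intro that[of "F (0 + T) - F 0"]) (auto simp: algebra_simps)
qed

text \<open>Separation of variables: \<open>\<theta>\<close> is the inverse of an antiderivative of \<open>1/h\<close>. The sign of
  \<open>h\<close> determines whether \<open>\<theta>\<close> gains or loses \<open>p\<close> over one period.\<close>

lemma periodic_autonomous_solution:
  fixes h :: "real \<Rightarrow> real"
  assumes cont: "continuous_on UNIV h" and nz: "\<And>a. h a \<noteq> 0"
    and per: "\<And>a. h (a + p) = h a" and "p \<noteq> 0"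
  obtains \<theta> T where "T > 0" "surj \<theta>" "\<And>t. (\<theta> has_real_derivative h (\<theta> t)) (at t)"
    "(\<forall>t. \<theta> (t + T) = \<theta> t + p) \<or> (\<forall>t. \<theta> (t + T) = \<theta> t - p)"
proof -
  obtain \<tau> where \<tau>: "\<And>a. (\<tau> has_real_derivative inverse (h a)) (at a)"
    using continuous_imp_antiderivative[of "\<lambda>a. inverse (h a)"] cont nz
    by (auto intro: continuous_intros)
  obtain K where K: "K \<noteq> 0" "\<And>a. \<tau> (a + p) = \<tau> a + K"
    using antiderivative_quasi_periodic[OF \<tau>, of p] nz per \<open>p \<noteq> 0\<close> by auto
  have cont_\<tau>: "continuous_on UNIV \<tau>"
    using \<tau> by (auto intro!: continuous_at_imp_continuous_on intro: DERIV_isCont)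
  have "inj \<tau>"
    using antiderivative_inj[OF \<tau>] nz by simp
  moreover have "surj \<tau>"
    using quasi_periodic_surj[OF cont_\<tau> K(2,1)] .
  ultimately obtain \<theta> where \<theta>: "\<And>a. \<theta> (\<tau> a) = a" "\<And>t. \<tau> (\<theta> t) = t"
    by (metis inv_f_f surj_f_inv_f)
  have "(\<theta> has_real_derivative h (\<theta> t)) (at t)" for t
  proof -
    have "(\<theta> has_derivative (*) (h (\<theta> t))) (at (\<tau> (\<theta> t)))"
    proof (rule has_derivative_inverse_strong[where f = \<tau> and S = UNIV])
      show "(\<tau> has_derivative (*) (inverse (h (\<theta> t)))) (at (\<theta> t))"
        using \<tau> by (simp add: has_field_derivative_def)
      show "(*) (inverse (h (\<theta> t))) \<circ> (*) (h (\<theta> t)) = id"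
        using nz by (auto simp: fun_eq_iff)
    qed (use \<theta> cont_\<tau> in auto)
    then show ?thesis
      by (simp add: has_field_derivative_def \<theta>)
  qed
  moreover have shift: "\<theta> (t + K) = \<theta> t + p" for t
    using K(2)[of "\<theta> t"] \<theta> by metis
  then have "\<theta> (t - K) = \<theta> t - p" for t
    using shift[of "t - K"] by simp
  \<comment> \<open>\<open>K\<close> may be negative, so the positive period is its absolute value,
    at the cost of a sign in front of \<open>p\<close>.\<close>
  with shift K(1) have "(\<forall>t. \<theta> (t + \<bar>K\<bar>) = \<theta> t + p) \<or> (\<forall>t. \<theta> (t + \<bar>K\<bar>) = \<theta> t - p)"
    by (cases "K > 0") auto
  moreover have "surj \<theta>"
    using \<theta>(1) by (metis surjI)
  ultimately show thesis
    using that[of "\<bar>K\<bar>" \<theta>] K(1) by simp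
qed

section \<open>Rotations of the plane with varying angular velocity\<close>

definition quarter_turn :: "real^2 \<Rightarrow> real^2" where
  "quarter_turn v = vector [- v $ 2, v $ 1]"

lemma quarter_turn_nth [simp]: "quarter_turn v $ 1 = - v $ 2" "quarter_turn v $ 2 = v $ 1"
  by (simp_all add: quarter_turn_def)

lemma norm_vec2: "norm (v :: real^2) = sqrt ((v $ 1)\<^sup>2 + (v $ 2)\<^sup>2)"
  by (simp add: norm_vec_def L2_set_def sum_2)

lemma vec2_polar:
  fixes v :: "real^2"
  obtains a where "v $ 1 = norm v * cos a" "v $ 2 = norm v * sin a"
proof (cases "v = 0")
  case False
  then have "(v $ 1 / norm v)\<^sup>2 + (v $ 2 / norm v)\<^sup>2 = 1"
    by (simp add: norm_vec2 power_divide add_divide_distrib[symmetric] vec_eq_iff forall_2 sum_power2_eq_zero_iff)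
  then obtain a where "v $ 1 / norm v = cos a" "v $ 2 / norm v = sin a"
    using sincos_total_2pi by metis
  with False that show thesis
    by (metis nonzero_mult_div_cancel_left norm_eq_zero times_divide_eq_right)
qed (use that in auto)

lemma has_vector_derivative_vec2:
  fixes u :: "real \<Rightarrow> real^2"
  shows "(u has_vector_derivative v) (at t) \<longleftrightarrow>
    ((\<lambda>t. u t $ 1) has_real_derivative v $ 1) (at t) \<and>
    ((\<lambda>t. u t $ 2) has_real_derivative v $ 2) (at t)"
  unfolding has_vector_derivative_def has_derivative_componentwise_within[of u]
    has_real_derivative_iff_has_vector_derivative
  by (auto simp: Basis_vec_def inner_axis exhaust_2 forall_2)

text \<open>\<open>u\<close> turns with angular velocity \<open>d\<close>. The total angle
  \<open>\<Theta>\<close> is an antiderivative of \<open>d\<close>, which is onto the reals because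
  \<open>d\<close> is periodic without zeros; so the full circle is swept.\<close>

lemma range_rotation:
  fixes u :: "real \<Rightarrow> real^2"
  assumes u: "\<And>t. (u has_vector_derivative d t *\<^sub>R quarter_turn (u t)) (at t)"
    and d: "continuous_on UNIV d" "\<And>t. d t \<noteq> 0" "\<And>t. d (t + T) = d t" and "T \<noteq> 0"
  shows "range u = sphere 0 (norm (u 0))"
proof -
  obtain \<Theta> where \<Theta>: "\<And>t. (\<Theta> has_real_derivative d t) (at t)"
    using continuous_imp_antiderivative[OF d(1)] by blast
  obtain K where K: "K \<noteq> 0" "\<And>t. \<Theta> (t + T) = \<Theta> t + K"
    using antiderivative_quasi_periodic[OF \<Theta> d(2,3) \<open>T \<noteq> 0\<close>] by blast
  have "continuous_on UNIV \<Theta>"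
    using \<Theta> by (auto intro!: continuous_at_imp_continuous_on intro: DERIV_isCont)
  then have surj: "surj \<Theta>"
    using quasi_periodic_surj K by blast
  have u1: "((\<lambda>t. u t $ 1) has_real_derivative - d t * u t $ 2) (at t)"
    and u2: "((\<lambda>t. u t $ 2) has_real_derivative d t * u t $ 1) (at t)" for t
    using u[of t] unfolding has_vector_derivative_vec2 by simp_all
  \<comment> \<open>\<open>a\<close> and \<open>b\<close> are the coordinates of \<open>u\<close>
    turned back by the angle \<open>\<Theta>\<close>; this cancels the motion.\<close>
  define a where "a = (\<lambda>t. cos (\<Theta> t) * u t $ 1 + sin (\<Theta> t) * u t $ 2)"
  define b where "b = (\<lambda>t. cos (\<Theta> t) * u t $ 2 - sin (\<Theta> t) * u t $ 1)"
  have "(a has_real_derivative 0) (at t)" for t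
    unfolding a_def
    by (rule derivative_eq_intros \<Theta> u1 u2 refl | simp add: algebra_simps)+
  then have a: "a t = a 0" for t
    using DERIV_isconst_all by blast
  have "(b has_real_derivative 0) (at t)" for t
    unfolding b_def
    by (rule derivative_eq_intros \<Theta> u1 u2 refl | simp add: algebra_simps)+
  then have b: "b t = b 0" for t
    using DERIV_isconst_all by blast
  have ut: "u t $ 1 = a 0 * cos (\<Theta> t) - b 0 * sin (\<Theta> t)"
    "u t $ 2 = a 0 * sin (\<Theta> t) + b 0 * cos (\<Theta> t)" for t
  proof -
    have "a t * cos (\<Theta> t) - b t * sin (\<Theta> t) = u t $ 1 * ((sin (\<Theta> t))\<^sup>2 + (cos (\<Theta> t))\<^sup>2)"
      "a t * sin (\<Theta> t) + b t * cos (\<Theta> t) = u t $ 2 * ((sin (\<Theta> t))\<^sup>2 + (cos (\<Theta> t))\<^sup>2)"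
      unfolding a_def b_def by algebra+
    then show "u t $ 1 = a 0 * cos (\<Theta> t) - b 0 * sin (\<Theta> t)"
      "u t $ 2 = a 0 * sin (\<Theta> t) + b 0 * cos (\<Theta> t)"
      by (simp_all add: a[of t] b[of t])
  qed
  define w :: "real^2" where "w = vector [a 0, b 0]"
  obtain \<alpha> where \<alpha>: "a 0 = norm w * cos \<alpha>" "b 0 = norm w * sin \<alpha>"
    using vec2_polar[of w] unfolding w_def vector_2 by blast
  have polar: "u t $ 1 = norm w * cos (\<alpha> + \<Theta> t)" "u t $ 2 = norm w * sin (\<alpha> + \<Theta> t)" for t
    unfolding ut \<alpha> by (simp_all add: cos_add sin_add algebra_simps)
  have nrm: "norm (u t) = norm w" for t
    unfolding norm_vec2[of "u t"] polar power_mult_distrib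
    by (simp add: distrib_left[symmetric])
  have "v \<in> range u" if v: "norm v = norm w" for v
  proof -
    obtain \<beta> where \<beta>: "v $ 1 = norm v * cos \<beta>" "v $ 2 = norm v * sin \<beta>"
      using vec2_polar by blast
    obtain t where "\<Theta> t = \<beta> - \<alpha>"
      using surj by (metis surjD)
    then have "v = u t"
      using \<beta> v by (simp add: vec_eq_iff forall_2 polar)
    then show ?thesis by blast
  qed
  then show ?thesis
    by (auto simp: nrm)
qed

text \<open>With \<open>A\<close> the Jacobian matrix and \<open>J\<close> the quarter turn, the
  gradient of \<open>half_norm_sq f\<close> is the transpose of \<open>A\<close> applied to
  \<open>f z\<close>, the field is \<open>J\<close> of it, and \<open>A J A^T = det A J\<close> for
  every 2 by 2 matrix.\<close>

lemma derivative_hamiltonian_field: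
  fixes f :: "real^2 \<Rightarrow> real^2"
  assumes "f differentiable at z"
  shows "jacobian f (at z) *v hamiltonian_field (half_norm_sq f) z =
    det (jacobian f (at z)) *\<^sub>R quarter_turn (f z)"
proof -
  define A where "A = jacobian f (at z)"
  have der: "(f has_derivative (\<lambda>v. A *v v)) (at z)"
    using assms jacobian_works A_def by blast
  have comp: "((\<lambda>x. f x $ i) has_derivative (\<lambda>v. (A *v v) $ i)) (at z)" for i
    using bounded_linear.has_derivative[OF bounded_linear_vec_nth der] .
  have "(half_norm_sq f has_derivative (\<lambda>v. f z $ 1 * (A *v v) $ 1 + f z $ 2 * (A *v v) $ 2)) (at z)"
    unfolding half_norm_sq_def
    by (rule derivative_eq_intros comp refl | simp add: algebra_simps fun_eq_iff)+
  then have fd: "frechet_derivative (half_norm_sq f) (at z) =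
      (\<lambda>v. f z $ 1 * (A *v v) $ 1 + f z $ 2 * (A *v v) $ 2)"
    by (rule frechet_derivative_at[symmetric])
  have pd: "partial_deriv i (half_norm_sq f) z = f z $ 1 * A $ 1 $ i + f z $ 2 * A $ 2 $ i" for i
    unfolding partial_deriv_def fd by (simp add: matrix_vector_mult_basis column_def)
  show ?thesis
    unfolding A_def[symmetric]
    by (simp add: vec_eq_iff forall_2 hamiltonian_field_def pd matrix_vector_mult_def sum_2 det_2
        algebra_simps)
qed

subsection \<open>The Hamiltonian field of half the squared norm\<close>

lemma C2_on_imp_C1_on:
  assumes "C2_on U f"
  shows "C1_on U f"
proof -
  from assms obtain f' where f': "\<And>x. x \<in> U \<Longrightarrow> (f has_derivative blinfun_apply (f' x)) (at x)"
      and "C1_on U f'"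
    unfolding C2_on_def by blast
  then obtain f'' where "\<And>x. x \<in> U \<Longrightarrow> (f' has_derivative blinfun_apply (f'' x)) (at x)"
    unfolding C1_on_def by blast
  then have "continuous_on U f'"
    by (meson continuous_at_imp_continuous_on has_derivative_continuous)
  with f' show ?thesis
    unfolding C1_on_def by blast
qed

lemma C1_on_differentiable:
  "C1_on U f \<Longrightarrow> z \<in> U \<Longrightarrow> f differentiable (at z)"
  unfolding C1_on_def differentiable_def by blast

lemma C1_on_det_jacobian_continuous:
  fixes f :: "real^2 \<Rightarrow> real^2"
  assumes "C1_on U f"
  shows "continuous_on U (\<lambda>z. det (jacobian f (at z)))"
proof -
  from assms obtain f' where f': "\<And>x. x \<in> U \<Longrightarrow> (f has_derivative blinfun_apply (f' x)) (at x)"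
      "continuous_on U f'"
    unfolding C1_on_def by blast
  have "jacobian f (at z) = matrix (blinfun_apply (f' z))" if "z \<in> U" for z
    unfolding jacobian_def using frechet_derivative_at[OF f'(1)[OF that]] by simp
  moreover have "continuous_on U (\<lambda>z. det (matrix (blinfun_apply (f' z))))"
    unfolding det_2 matrix_def
    by (simp, intro continuous_intros blinfun.continuous_on f'(2))
  ultimately show ?thesis
    by (simp cong: continuous_on_cong)
qed

lemma C1_on_locally_injective:
  fixes f :: "real^'n \<Rightarrow> real^'n"
  assumes "open U" "C1_on U f" "p \<in> U" "det (jacobian f (at p)) \<noteq> 0"
  obtains N where "open N" "p \<in> N" "N \<subseteq> U" "inj_on f N"
proof -
  from assms obtain f' where f': "\<And>x. x \<in> U \<Longrightarrow> (f has_derivative blinfun_apply (f' x)) (at x)"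
      "continuous_on U f'"
    unfolding C1_on_def by blast
  define A where "A = jacobian f (at p)"
  have "blinfun_apply (f' p) = (\<lambda>v. A *v v)"
    using has_derivative_unique[OF f'(1)[OF \<open>p \<in> U\<close>]] jacobian_works[of f "at p"]
      C1_on_differentiable[OF assms(2,3)] unfolding A_def by blast
  moreover obtain B where "B ** A = mat 1"
    using assms(4) unfolding A_def invertible_det_nz[symmetric] invertible_def by blast
  ultimately have "Blinfun (\<lambda>v. B *v v) o\<^sub>L f' p = id_blinfun"
    by (intro blinfun_eqI)
      (simp add: bounded_linear_Blinfun_apply matrix_vector_mul_bounded_linear matrix_vector_mul_assoc)
  from inverse_function_theorem[OF \<open>open U\<close> f' \<open>p \<in> U\<close> this]
  obtain N V g where "open N" "N \<subseteq> U" "p \<in> N" "homeomorphism N V f g"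
    by metis
  then show thesis
    using that[of N] by (metis homeomorphism_apply1 inj_on_inverseI)
qed

lemma hamiltonian_field_eq_0_iff:
  fixes f :: "real^2 \<Rightarrow> real^2"
  assumes "f differentiable at z" and nz: "det (jacobian f (at z)) \<noteq> 0"
  shows "hamiltonian_field (half_norm_sq f) z = 0 \<longleftrightarrow> f z = 0"
proof -
  let ?A = "jacobian f (at z)" and ?X = "hamiltonian_field (half_norm_sq f) z"
  obtain B where "B ** ?A = mat 1"
    using nz unfolding invertible_det_nz[symmetric] invertible_def by blast
  then have "B *v (?A *v ?X) = ?X"
    by (simp add: matrix_vector_mul_assoc)
  then have "?X = 0 \<longleftrightarrow> ?A *v ?X = 0"
    by (metis matrix_vector_mult_0_right)
  also have "\<dots> \<longleftrightarrow> quarter_turn (f z) = 0"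
    using nz by (simp add: derivative_hamiltonian_field[OF assms(1)])
  also have "\<dots> \<longleftrightarrow> f z = 0"
    by (auto simp: vec_eq_iff forall_2)
  finally show ?thesis .
qed

text \<open>\<open>f \<circ> x\<close> rotates with the Jacobian determinant along \<open>x\<close>
  as angular velocity, which is continuous, periodic and never zero.\<close>

lemma periodic_orbit_image:
  fixes f :: "real^2 \<Rightarrow> real^2" and x :: "real \<Rightarrow> real^2"
  assumes diff: "\<And>z. z \<in> U \<Longrightarrow> f differentiable (at z)"
    and cont: "continuous_on U (\<lambda>z. det (jacobian f (at z)))"
    and nz: "\<And>z. z \<in> U \<Longrightarrow> det (jacobian f (at z)) \<noteq> 0"
    and x: "\<And>t. x t \<in> U"
      "\<And>t. (x has_vector_derivative hamiltonian_field (half_norm_sq f) (x t)) (at t)"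
    and T: "T \<noteq> 0" "\<And>t. x (t + T) = x t"
  shows "f ` range x = sphere 0 (norm (f (x 0)))"
proof -
  let ?d = "\<lambda>t. det (jacobian f (at (x t)))"
  have "((f \<circ> x) has_vector_derivative ?d t *\<^sub>R quarter_turn ((f \<circ> x) t)) (at t)" for t
  proof -
    have "(f has_derivative (\<lambda>v. jacobian f (at (x t)) *v v)) (at (x t))"
      using diff x(1) jacobian_works by blast
    from vector_derivative_diff_chain_within[OF x(2) has_derivative_at_withinI[OF this]]
    show ?thesis
      by (simp add: derivative_hamiltonian_field[OF diff[OF x(1)]])
  qed
  moreover have "continuous_on UNIV x"
    using x(2) by (auto intro!: continuous_at_imp_continuous_on has_vector_derivative_continuous)
  then have "continuous_on UNIV ?d"
    using x(1) by (intro continuous_on_compose2[OF cont]) auto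
  ultimately have "range (f \<circ> x) = sphere 0 (norm ((f \<circ> x) 0))"
    using x(1) nz T by (intro range_rotation[of _ ?d T]) auto
  then show ?thesis
    by (simp add: image_comp)
qed

text \<open>Moving along the circle at the angular speed that the field dictates on the lifted point
  is a scalar periodic equation for the angle; its solution, lifted by the inverse branch, is the
  orbit.\<close>

lemma periodic_orbit_over_circle:
  fixes f :: "real^2 \<Rightarrow> real^2"
  assumes W: "open W" "W \<subseteq> U" "inj_on f W"
    and diff: "\<And>z. z \<in> W \<Longrightarrow> f differentiable (at z)"
    and cont: "continuous_on W (\<lambda>z. det (jacobian f (at z)))"
    and nz: "\<And>z. z \<in> W \<Longrightarrow> det (jacobian f (at z)) \<noteq> 0"
    and s: "s > 0" "sphere 0 s \<subseteq> f ` W" and z: "z \<in> W" "norm (f z) = s"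
  obtains C where "periodic_orbit (hamiltonian_field (half_norm_sq f)) U C" "z \<in> C" "C \<subseteq> W"
    "f ` C \<subseteq> sphere 0 s"
proof -
  let ?X = "hamiltonian_field (half_norm_sq f)"
  have contf: "continuous_on W f"
    using diff by (intro continuous_at_imp_continuous_on) (auto intro: differentiable_imp_continuous_within)
  obtain g where g: "homeomorphism W (f ` W) f g"
    using invariance_of_domain_homeomorphism[OF W(1) contf _ W(3)] by blast
  have open_img: "open (f ` W)"
    using invariance_of_domain contf W by blast
  define c :: "real \<Rightarrow> real^2" where "c = (\<lambda>a. vector [s * cos a, s * sin a])"
  have c_nth [simp]: "c a $ 1 = s * cos a" "c a $ 2 = s * sin a" for a
    by (simp_all add: c_def)
  have norm_c: "norm (c a) = s" for a
    using s(1) by (simp add: norm_vec2 power_mult_distrib distrib_left[symmetric])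
  then have cW: "c a \<in> f ` W" for a
    using s(2) by auto
  then have gW: "g (c a) \<in> W" for a
    using homeomorphism_image2[OF g] by blast
  have fg: "f (g (c a)) = c a" for a
    using homeomorphism_apply2[OF g cW] .
  \<comment> \<open>The angular speed at angle \<open>a\<close>, read at the point of
    \<open>W\<close> lying over \<open>c a\<close>.\<close>
  define h where "h = (\<lambda>a. det (jacobian f (at (g (c a)))))"
  have c_per: "c (a + 2 * pi) = c a" for a
    by (simp add: vec_eq_iff forall_2)
  have "continuous_on UNIV c"
    unfolding continuous_on_componentwise[of UNIV c]
    by (auto simp: Basis_vec_def inner_axis exhaust_2 forall_2 intro!: continuous_intros)
  then have "continuous_on UNIV (\<lambda>a. g (c a))"
    using cW by (intro continuous_on_compose2[OF homeomorphism_cont2[OF g]]) auto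
  then have "continuous_on UNIV h"
    unfolding h_def using gW by (intro continuous_on_compose2[OF cont]) auto
  moreover have "h a \<noteq> 0" "h (a + 2 * pi) = h a" for a
    using nz gW by (simp_all add: h_def c_per)
  ultimately obtain \<theta> T where \<theta>: "T > 0" "surj \<theta>"
      "\<And>t. (\<theta> has_real_derivative h (\<theta> t)) (at t)"
      "(\<forall>t. \<theta> (t + T) = \<theta> t + 2 * pi) \<or> (\<forall>t. \<theta> (t + T) = \<theta> t - 2 * pi)"
    using periodic_autonomous_solution[of h "2 * pi"] by (metis pi_neq_zero mult_eq_0_iff zero_neq_numeral)
  define x where "x = (\<lambda>t. g (c (\<theta> t)))"
  have fx: "f (x t) = c (\<theta> t)" for t
    by (simp add: x_def fg)
  have xW: "x t \<in> W" for t
    by (simp add: x_def gW)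
  \<comment> \<open>The derivative of \<open>g\<close> is the inverse matrix \<open>B\<close>, which
    undoes the factor \<open>A\<close> in \<open>derivative_hamiltonian_field\<close>.\<close>
  have "(x has_vector_derivative ?X (x t)) (at t)" for t
  proof -
    define A where "A = jacobian f (at (x t))"
    obtain B where B: "B ** A = mat 1"
      using nz[OF xW] unfolding A_def invertible_det_nz[symmetric] invertible_def by blast
    have "(f has_derivative (\<lambda>v. A *v v)) (at (x t))"
      unfolding A_def using diff[OF xW] jacobian_works by blast
    then have dg: "(g has_derivative (\<lambda>v. B *v v)) (at (c (\<theta> t)))"
      unfolding x_def
    proof (rule has_derivative_inverse_basic)
      show "bounded_linear (\<lambda>v. B *v v)"
        by (rule matrix_vector_mul_bounded_linear)
      show "(\<lambda>v. B *v v) \<circ> (\<lambda>v. A *v v) = id"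
        using B by (simp add: fun_eq_iff matrix_vector_mul_assoc)
      show "continuous (at (c (\<theta> t))) g"
        using homeomorphism_cont2[OF g] open_img cW continuous_on_eq_continuous_at by blast
      show "f (g w) = w" if "w \<in> f ` W" for w
        using homeomorphism_apply2[OF g that] .
    qed (use open_img cW in auto)
    have "((\<lambda>t. c (\<theta> t)) has_vector_derivative h (\<theta> t) *\<^sub>R quarter_turn (c (\<theta> t))) (at t)"
      unfolding has_vector_derivative_vec2 c_nth vector_scaleR_component quarter_turn_nth
      by (auto intro!: derivative_eq_intros \<theta>(3))
    from vector_derivative_diff_chain_within[OF this has_derivative_at_withinI[OF dg]]
    have "(x has_vector_derivative B *v (h (\<theta> t) *\<^sub>R quarter_turn (c (\<theta> t)))) (at t)"
      by (simp add: x_def o_def)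
    also have "h (\<theta> t) *\<^sub>R quarter_turn (c (\<theta> t)) = A *v ?X (x t)"
      using derivative_hamiltonian_field[OF diff[OF xW]] by (simp add: A_def h_def fx x_def fg)
    also have "B *v (A *v ?X (x t)) = ?X (x t)"
      using B by (simp add: matrix_vector_mul_assoc)
    finally show ?thesis .
  qed
  moreover have "x (t + T) = x t" for t
    using \<theta>(4) c_per[of "\<theta> t"] c_per[of "\<theta> t - 2 * pi"] by (auto simp: x_def)
  moreover have "\<exists>t t'. x t \<noteq> x t'"
  proof -
    \<comment> \<open>Opposite points of the circle, with first coordinates \<open>s\<close> and
      \<open>-s\<close>.\<close>
    obtain t t' where "\<theta> t = 0" "\<theta> t' = pi"
      using \<theta>(2) by (metis surjD)
    then have "f (x t) $ 1 \<noteq> f (x t') $ 1"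
      using s(1) by (simp add: fx)
    then show ?thesis by metis
  qed
  ultimately have "periodic_orbit ?X U (range x)"
    unfolding periodic_orbit_def using xW W(2) \<theta>(1) by blast
  moreover have "z \<in> range x"
  proof -
    obtain a where a: "f z $ 1 = norm (f z) * cos a" "f z $ 2 = norm (f z) * sin a"
      using vec2_polar by blast
    obtain t where "\<theta> t = a"
      using \<theta>(2) by (metis surjD)
    then have "f z = c (\<theta> t)"
      using a z(2) by (simp add: vec_eq_iff forall_2)
    then have "x t = z"
      using homeomorphism_apply1[OF g z(1)] by (simp add: x_def)
    then show ?thesis by blast
  qed
  moreover have "range x \<subseteq> W" "f ` range x \<subseteq> sphere 0 s"
    using xW norm_c by (auto simp: fx)
  ultimately show thesis
    using that by blast
qed

section \<open>Identification of the period annulus with the maximal sheet\<close>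

theorem corollary3:
  fixes U :: "(real^2) set" and f :: "real^2 \<Rightarrow> real^2" and z0 :: "real^2"
  assumes "open U" and "connected U"
    and "C2_on U f"
    and "\<And>z. z \<in> U \<Longrightarrow> det (jacobian f (at z)) \<noteq> 0"
    and "z0 \<in> U" and "f z0 = 0"
  defines "X \<equiv> hamiltonian_field (half_norm_sq f)"
  defines "P \<equiv> period_annulus X U z0"
  shows "is_center X U z0 \<and>
    inj_on f (closure P \<inter> U) \<and>
    (f ` P = UNIV \<or> (\<exists>r>0. f ` P = ball 0 r))"
proof -
  have C1: "C1_on U f"
    using assms(3) by (rule C2_on_imp_C1_on)
  note diff = C1_on_differentiable[OF C1] and cont = C1_on_det_jacobian_continuous[OF C1]
    and nz = assms(4)
  interpret local_inversion f U z0
  proof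
    show "continuous_on U f"
      using diff by (intro continuous_at_imp_continuous_on) (auto intro: differentiable_imp_continuous_within)
    show "\<exists>N. open N \<and> p \<in> N \<and> N \<subseteq> U \<and> inj_on f N" if "p \<in> U" for p
      using C1_on_locally_injective[OF assms(1) C1 that nz[OF that]] by metis
  qed (use assms in auto)
  have W: "open max_sheet" "max_sheet \<subseteq> U" "inj_on f max_sheet"
    using sheet_max_sheet by (auto simp: sheet_def)
  have f_nz: "f z \<noteq> 0" if "z \<in> max_sheet" "z \<noteq> z0" for z
    using that inj_onD[OF W(3) _ that(1) z0_in_max_sheet] f_z0 by auto
  have filled: "filled_with_periodic_orbits X U (max_sheet - {z0})"
  proof -
    let ?\<C> = "{C. periodic_orbit X U C \<and> C \<subseteq> max_sheet - {z0}}"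
    have "z \<in> \<Union>?\<C>" if z: "z \<in> max_sheet" "z \<noteq> z0" for z
    proof -
      have s: "norm (f z) > 0"
        using f_nz z by simp
      have "sphere 0 (norm (f z)) \<subseteq> f ` max_sheet"
      proof -
        have "f z \<in> f ` max_sheet"
          using z(1) by (rule imageI)
        with f_max_sheet have "f ` max_sheet = UNIV \<or>
            (\<exists>R. norm (f z) < R \<and> f ` max_sheet = ball 0 R)"
          by (metis mem_ball_0)
        then show ?thesis
          by auto
      qed
      then obtain C where C: "periodic_orbit X U C" "z \<in> C" "C \<subseteq> max_sheet"
          "f ` C \<subseteq> sphere 0 (norm (f z))"
        using periodic_orbit_over_circle[OF W diff _ _ s _ z(1), unfolded X_def[symmetric]]
          W(2) nz continuous_on_subset[OF cont W(2)] by blast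
      \<comment> \<open>\<open>f\<close> sends \<open>C\<close> to a sphere of positive radius but
        \<open>z0\<close> to its centre.\<close>
      have "z0 \<notin> C"
        using C(4) s f_z0 by force
      then show ?thesis
        using C by blast
    qed
    then have "max_sheet - {z0} = \<Union>?\<C>"
      by blast
    then show ?thesis
      unfolding filled_with_periodic_orbits_def by (intro exI[of _ ?\<C>]) simp
  qed
  have "annular_region X U z0 max_sheet"
    unfolding annular_region_def
    using W connected_max_sheet z0_in_max_sheet filled by blast
  from period_annulus[OF this] have P: "annular_region X U z0 P" "max_sheet \<subseteq> P"
    unfolding P_def by simp_all
  have "P \<subseteq> max_sheet"
  proof (rule ccontr)
    assume "\<not> P \<subseteq> max_sheet"
    then have "P \<inter> frontier max_sheet \<noteq> {}"
      using P z0_in_max_sheet by (intro connected_Int_frontier) (auto simp: annular_region_def)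
    then obtain p where p: "p \<in> P" "p \<in> closure max_sheet" "p \<notin> max_sheet"
      using W(1) by (auto simp: frontier_def interior_open)
    then have "p \<in> P - {z0}" "p \<in> U"
      using z0_in_max_sheet P by (auto simp: annular_region_def)
    then obtain C where "periodic_orbit X U C" "p \<in> C"
      using P unfolding annular_region_def filled_with_periodic_orbits_def by blast
    then obtain x T t0 where x: "\<And>t. x t \<in> U" "\<And>t. (x has_vector_derivative X (x t)) (at t)"
        "T > 0" "\<And>t. x (t + T) = x t" "p = x t0"
      unfolding periodic_orbit_def by blast
    have circ: "f ` range x = sphere 0 (norm (f (x 0)))"
      using periodic_orbit_image[OF diff cont nz x(1) x(2)[unfolded X_def] _ x(4)] x(3) by simp
    obtain R where R: "R > 0" "f ` max_sheet = ball 0 R" "norm (f p) = R"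
      using norm_f_frontier p \<open>p \<in> U\<close> by blast
    \<comment> \<open>The orbit lies over a single circle, and its point \<open>p\<close> determines
      the radius as \<open>R\<close>.\<close>
    have "f p \<in> f ` range x"
      using x(5) by blast
    then have "f ` range x = sphere 0 R"
      unfolding circ using R(3) by simp
    moreover have "continuous_on UNIV x"
      using x(2) by (auto intro!: continuous_at_imp_continuous_on has_vector_derivative_continuous)
    ultimately show False
      using no_closed_curve_at_boundary[OF R(2,1), of x t0] x(1,5) p(2) by blast
  qed
  with P have P_eq: "P = max_sheet"
    by blast
  \<comment> \<open>\<open>max_sheet\<close> serves both as the neighbourhood isolating the zero and
    as the one filled with periodic orbits.\<close>
  have "is_center X U z0"
    unfolding is_center_def isolated_zero_def
    using hamiltonian_field_eq_0_iff[OF diff nz] f_z0 z0_in_U W(1,2) f_nz z0_in_max_sheet filled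
    unfolding X_def by blast
  then show ?thesis
    unfolding P_eq using inj_on_closure_max_sheet f_max_sheet by blast
qed

end
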